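(* Let $G$ be a simple graph with vertex set $V=\{v_1,\ldots,v_n\}$ and edge set $E$, and let $A$ be a parameter list for $G$. The map $R\mapsto\mathcal{O}_R$ restricts to a bijection from the set of relatively bounded regions of $\Sigma_G(A)$ to the set of $A$-admissible partial orientations $\mathcal{O}$ of $G$ such that every step in $\mathcal{O}$ belongs to some potential cycle for $\mathcal{O}$.
   Context: A parameter list $A$ assigns to each edge $\{v_i,v_j\}\in E$ two real numbers $a_{ij},a_{ji}$, such that some $x\in\mathbb{R}^n$ satisfies $x_i-x_j<a_{ij}$ and $x_j-x_i<a_{ji}$ for all edges. $\Sigma_G(A)$ is the arrangement of hyperplanes $x_i-x_j=a_{ij}$ in $\mathbb{R}^n$, one for each ordered pair $(i,j)$ with $\{v_i,v_j\}\in E$; regions are the connected components of its complement. A region $R$ is relatively bounded if $R\cap W$ is bounded, where $W=\{x\in\mathbb{R}^n:\sum_i x_i=0\}$ is the span of the normals of the hyperplanes. A step is an ordered pair $(u,v)$ with $\{u,v\}\in E$; a partial orientation $\mathcal{O}$ is a set of steps containing at most one of $(u,v),(v,u)$ for each edge; edges with neither are blank. $\mathcal{O}_R$ is defined by $(v_i,v_j)\in\mathcal{O}_R$ iff $x_j>x_i+a_{ji}$ on $R$. A step $(u,v)$ is compatible with $\mathcal{O}$ if $(v,u)\notin\mathcal{O}$; a potential cycle for $\mathcal{O}$ is a set $\{(u_1,u_2),\ldots,(u_k,u_1)\}$ of compatible steps. The score of a compatible step $(v_i,v_j)$ is $a_{ij}$ if the edge is blank and $-a_{ji}$ if $(v_i,v_j)\in\mathcal{O}$;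 a potential cycle's score is the sum over its steps. $\mathcal{O}$ is $A$-admissible if every potential cycle for $\mathcal{O}$ has positive score.
   Formalization: W is taken as the span of the normals, which equals {sum of x_i = 0} only when G is connected (with the latter W the claim fails for every disconnected G), and a potential cycle has distinct vertices u_1,...,u_k (with repeated vertices the set-based score makes the claim fail). *)

theory Defs
  imports "HOL-Analysis.Analysis"
begin

text \<open>
  The vertices v_1, ..., v_n are the elements of a finite type \<open>'n\<close>, so that R^n is \<open>real ^ 'n\<close>.
  A graph is given by its edge set; a parameter list is a function \<open>A\<close> with \<open>A i j\<close> in the role
  of a_ij, whose values outside the edges are never used.
\<close>

definition simple_graph :: "'n set set \<Rightarrow> bool" where
  "simple_graph E \<longleftrightarrow> (\<forall>e\<in>E. card e = 2)"

definition parameter_list :: "'n::finite set set \<Rightarrow> ('n \<Rightarrow> 'n \<Rightarrow> real) \<Rightarrow> bool" where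
  "parameter_list E A \<longleftrightarrow>
     (\<exists>x :: real ^ 'n. \<forall>i j. {i, j} \<in> E \<longrightarrow> x $ i - x $ j < A i j \<and> x $ j - x $ i < A j i)"

definition steps :: "'n set set \<Rightarrow> ('n \<times> 'n) set" where
  "steps E = {(u, v). {u, v} \<in> E}"

definition hyperplane :: "('n::finite \<Rightarrow> 'n \<Rightarrow> real) \<Rightarrow> 'n \<times> 'n \<Rightarrow> (real ^ 'n) set" where
  "hyperplane A = (\<lambda>(i, j). {x. x $ i - x $ j = A i j})"

definition arrangement ::
    "'n::finite set set \<Rightarrow> ('n \<Rightarrow> 'n \<Rightarrow> real) \<Rightarrow> (real ^ 'n) set set" where
  "arrangement E A = hyperplane A ` steps E"

definition regions ::
    "'n::finite set set \<Rightarrow> ('n \<Rightarrow> 'n \<Rightarrow> real) \<Rightarrow> (real ^ 'n) set set" where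
  "regions E A = components (- \<Union>(arrangement E A))"

definition normals :: "'n::finite set set \<Rightarrow> (real ^ 'n) set" where
  "normals E = (\<lambda>(i, j). axis i 1 - axis j 1) ` steps E"

text \<open>
  Relative boundedness refers to the span of the normals. For a connected graph this is the space
  of vectors with coordinate sum 0 (lemma \<open>span_normals_connected\<close>). For a disconnected graph the
  latter space is strictly larger, and no region would have a bounded intersection with it.
\<close>

definition relatively_bounded :: "'n::finite set set \<Rightarrow> (real ^ 'n) set \<Rightarrow> bool" where
  "relatively_bounded E R \<longleftrightarrow> bounded (R \<inter> span (normals E))"

lemma span_normals_connected:
  fixes E :: "'n::finite set set"
  assumes connected: "\<And>u v. (u, v) \<in> (steps E)\<^sup>*"
  shows "span (normals E) = {x :: real ^ 'n. (\<Sum>i\<in>UNIV. x $ i) = 0}"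
proof
  have "subspace {x :: real ^ 'n. (\<Sum>i\<in>UNIV. x $ i) = 0}"
    by (simp add: subspace_def sum.distrib flip: sum_distrib_left)
  moreover have "normals E \<subseteq> {x :: real ^ 'n. (\<Sum>i\<in>UNIV. x $ i) = 0}"
    by (auto simp: normals_def axis_def sum_subtractf)
  ultimately show "span (normals E) \<subseteq> {x :: real ^ 'n. (\<Sum>i\<in>UNIV. x $ i) = 0}"
    by (rule span_minimal[rotated])
next
  have diff: "axis u 1 - axis v 1 \<in> span (normals E)" for u v
    using connected[of u v]
  proof (induction rule: rtrancl_induct)
    case base
    show ?case by (simp add: span_zero)
  next
    case (step v w)
    then have "axis v 1 - axis w 1 \<in> span (normals E)"
      by (intro span_base) (auto simp: normals_def)
    from span_add[OF step.IH this] show ?case by simp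
  qed
  show "{x :: real ^ 'n. (\<Sum>i\<in>UNIV. x $ i) = 0} \<subseteq> span (normals E)"
  proof
    fix x :: "real ^ 'n"
    assume "x \<in> {x. (\<Sum>i\<in>UNIV. x $ i) = 0}"
    then have sum0: "(\<Sum>i\<in>UNIV. x $ i) = 0" by simp
    fix r :: 'n
    have "(\<Sum>i\<in>UNIV. x $ i *\<^sub>R (axis i 1 - axis r 1))
        = (\<Sum>i\<in>UNIV. x $ i *\<^sub>R axis i 1) - (\<Sum>i\<in>UNIV. x $ i) *\<^sub>R axis r 1"
      by (simp add: scaleR_diff_right sum_subtractf scaleR_sum_left)
    also have "\<dots> = x"
      using basis_expansion[of x] sum0 by (simp add: scalar_mult_eq_scaleR)
    finally show "x \<in> span (normals E)"
      using span_sum[of UNIV "\<lambda>i. x $ i *\<^sub>R (axis i 1 - axis r 1)" "normals E"]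
      by (simp add: span_scale diff)
  qed
qed

definition partial_orientation :: "'n set set \<Rightarrow> ('n \<times> 'n) set \<Rightarrow> bool" where
  "partial_orientation E \<O> \<longleftrightarrow>
     \<O> \<subseteq> steps E \<and> (\<forall>u v. \<not> ((u, v) \<in> \<O> \<and> (v, u) \<in> \<O>))"

definition region_orientation ::
    "'n::finite set set \<Rightarrow> ('n \<Rightarrow> 'n \<Rightarrow> real) \<Rightarrow> (real ^ 'n) set \<Rightarrow> ('n \<times> 'n) set" where
  "region_orientation E A R = {(i, j) \<in> steps E. \<forall>x\<in>R. x $ j > x $ i + A j i}"

definition compatible :: "'n set set \<Rightarrow> ('n \<times> 'n) set \<Rightarrow> 'n \<times> 'n \<Rightarrow> bool" where
  "compatible E \<O> = (\<lambda>(u, v). (u, v) \<in> steps E \<and> (v, u) \<notin> \<O>)"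

text \<open>
  The vertices u_1, ..., u_k of a potential cycle are distinct, as usual for cycles. The case
  k = 2, in which a blank edge is traversed back and forth, is allowed; k = 1 is impossible because
  a simple graph has no loops.
\<close>

definition potential_cycle ::
    "'n set set \<Rightarrow> ('n \<times> 'n) set \<Rightarrow> ('n \<times> 'n) set \<Rightarrow> bool" where
  "potential_cycle E \<O> C \<longleftrightarrow>
     (\<exists>us. us \<noteq> [] \<and> distinct us \<and> C = set (zip us (rotate1 us)) \<and> (\<forall>s\<in>C. compatible E \<O> s))"

text \<open>Only meaningful for compatible steps, for which the second case means a blank edge.\<close>

definition step_score ::
    "('n \<Rightarrow> 'n \<Rightarrow> real) \<Rightarrow> ('n \<times> 'n) set \<Rightarrow> 'n \<times> 'n \<Rightarrow> real" where
  "step_score A \<O> = (\<lambda>(i, j). if (i, j) \<in> \<O> then - A j i else A i j)"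

definition cycle_score ::
    "('n \<Rightarrow> 'n \<Rightarrow> real) \<Rightarrow> ('n \<times> 'n) set \<Rightarrow> ('n \<times> 'n) set \<Rightarrow> real" where
  "cycle_score A \<O> C = (\<Sum>s\<in>C. step_score A \<O> s)"

definition admissible ::
    "'n set set \<Rightarrow> ('n \<Rightarrow> 'n \<Rightarrow> real) \<Rightarrow> ('n \<times> 'n) set \<Rightarrow> bool" where
  "admissible E A \<O> \<longleftrightarrow> (\<forall>C. potential_cycle E \<O> C \<longrightarrow> cycle_score A \<O> C > 0)"

end

theory Submission
  imports Defs
begin

text \<open>
  The regions are the nonempty cells cut out by the difference constraints x_i - x_j < score(i,j),
  one for each compatible step (i,j). Summing constraints around a potential cycle, the left sides
  cancel, so a nonempty cell forces positive scores; conversely, after lowering all scores by a small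
  amount, shortest-path distances solve the system. Around a potential cycle the slacks of the
  constraints are positive and add up to the score, which bounds the coordinate differences along
  its steps. If a step (u,v) of the orientation is on no potential cycle, then u is not reachable from
  v, and raising all coordinates reachable from v never leaves the cell.
\<close>

section \<open>Simple paths and cycles in a finite digraph\<close>

fun path_sum :: "('a \<times> 'a \<Rightarrow> real) \<Rightarrow> 'a list \<Rightarrow> real" where
  "path_sum w (x # y # zs) = w (x, y) + path_sum w (y # zs)"
| "path_sum w _ = 0"

lemma path_sum_append:
  "path_sum w (xs @ a # ys) = path_sum w (xs @ [a]) + path_sum w (a # ys)"
proof (induction xs)
  case (Cons x xs)
  then show ?case by (cases xs) auto
qed simp

text \<open>Since \<open>rotate1 (x # xs) = xs @ [x]\<close>, the case \<open>a = x\<close> of this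
  and the next lemma lets a cycle be treated as the closed walk \<open>x # xs @ [x]\<close>.\<close>

lemma sum_list_zip_shift:
  "sum_list (map w (zip (x # xs) (xs @ [a]))) = path_sum w (x # xs @ [a])"
  by (induction xs arbitrary: x) auto

lemma ball_zip_shift:
  "(\<forall>s\<in>set (zip (x # xs) (xs @ [a])). s \<in> r) \<longleftrightarrow> successively (\<lambda>u v. (u, v) \<in> r) (x # xs @ [a])"
  by (induction xs arbitrary: x) auto

text \<open>Induction prepends one step at a time; if the new vertex already lies on the path,
  everything before its occurrence is cut off, which keeps the path simple.\<close>

lemma rtrancl_imp_simple_path:
  assumes "(a, b) \<in> r\<^sup>*"
  shows "\<exists>p. distinct (a # p) \<and> last (a # p) = b \<and> successively (\<lambda>u v. (u, v) \<in> r) (a # p)"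
  using assms
proof (induction rule: converse_rtrancl_induct)
  case base
  show ?case by (rule exI[of _ "[]"]) simp
next
  case (step a c)
  then obtain p where p: "distinct (c # p)" "last (c # p) = b"
      "successively (\<lambda>u v. (u, v) \<in> r) (c # p)"
    by blast
  show ?case
  proof (cases "a \<in> set (c # p)")
    case True
    then obtain ys zs where split: "c # p = ys @ a # zs"
      by (meson split_list)
    have "distinct (a # zs)" "last (a # zs) = b" "successively (\<lambda>u v. (u, v) \<in> r) (a # zs)"
      using p unfolding split by (auto simp: successively_append_iff)
    then show ?thesis by blast
  next
    case False
    then have "distinct (a # c # p)" "last (a # c # p) = b"
        "successively (\<lambda>u v. (u, v) \<in> r) (a # c # p)"
      using p step.hyps by auto
    then show ?thesis by blast
  qed
qed

text \<open>The potential at \<open>i\<close> is the least weight of a simple path that starts at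
  \<open>i\<close> and ends anywhere. Simplicity makes this a minimum over a finite set, nonempty
  because of the trivial path; nonnegative cycles give the triangle inequality.\<close>

lemma feasible_potential_weak:
  fixes r :: "('n::finite \<times> 'n) set" and w :: "'n \<times> 'n \<Rightarrow> real"
  assumes cycle: "\<And>us. \<lbrakk>us \<noteq> []; distinct us; \<forall>s\<in>set (zip us (rotate1 us)). s \<in> r\<rbrakk>
      \<Longrightarrow> 0 \<le> sum_list (map w (zip us (rotate1 us)))"
  shows "\<exists>x. \<forall>(i, j)\<in>r. x i - x j \<le> w (i, j)"
proof -
  define Q where "Q i = {p. distinct (i # p) \<and> successively (\<lambda>u v. (u, v) \<in> r) (i # p)}" for i
  define x where "x i = Min ((\<lambda>p. path_sum w (i # p)) ` Q i)" for i
  have fin: "finite (Q i)" for i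
    by (rule finite_subset[OF _ finite_subset_distinct[of "UNIV :: 'n set"]]) (auto simp: Q_def)
  have ne: "Q i \<noteq> {}" for i
  proof -
    have "[] \<in> Q i" by (simp add: Q_def)
    then show ?thesis by blast
  qed
  have le: "x i \<le> path_sum w (i # p)" if "p \<in> Q i" for i p
    unfolding x_def using fin that by (intro Min_le) auto
  have "x i \<le> w (i, j) + x j" if ij: "(i, j) \<in> r" for i j
  proof -
    have "x j \<in> (\<lambda>p. path_sum w (j # p)) ` Q j"
      unfolding x_def using fin ne by (intro Min_in) auto
    then obtain p where p: "p \<in> Q j" and xj: "x j = path_sum w (j # p)"
      by blast
    \<comment> \<open>If \<open>p\<close> returns to \<open>i\<close>, prepending \<open>i\<close> closes a cycle, whose removal does not increase the sum.\<close>
    show ?thesis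
    proof (cases "i \<in> set (j # p)")
      case False
      then have "j # p \<in> Q i"
        using p ij by (auto simp: Q_def)
      from le[OF this] show ?thesis by (simp add: xj)
    next
      case True
      then obtain ys zs where split: "j # p = ys @ i # zs"
        by (meson split_list)
      have dist: "distinct (i # ys)" and zs: "zs \<in> Q i"
        and succ: "successively (\<lambda>u v. (u, v) \<in> r) (ys @ [i])"
        using p unfolding Q_def mem_Collect_eq split by (auto simp: successively_append_iff)
      \<comment> \<open>If \<open>ys\<close> is empty then \<open>i = j\<close>, and the cycle being
        removed is a loop.\<close>
      have hd: "hd (ys @ [i]) = j"
        using split by (cases ys) auto
      then have "successively (\<lambda>u v. (u, v) \<in> r) (i # ys @ [i])"
        using succ ij by (auto simp: successively_Cons)
      then have "0 \<le> path_sum w (i # ys @ [i])"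
        using cycle[of "i # ys"] dist ball_zip_shift[of i ys i r] sum_list_zip_shift[of w i ys i]
        by simp
      also have "\<dots> = w (i, j) + path_sum w (ys @ [i])"
        using hd by (cases ys) auto
      finally have "path_sum w (i # zs) \<le> w (i, j) + path_sum w (j # p)"
        unfolding split by (simp add: path_sum_append[of w ys i zs])
      with le[OF zs] show ?thesis by (simp add: xj)
    qed
  qed
  then show ?thesis
    by (intro exI[of _ x]) (auto simp: algebra_simps)
qed

text \<open>All weights are lowered by the same \<open>e > 0\<close>. A simple cycle has at most
  \<open>CARD('n)\<close> steps, so it loses at most \<open>m\<close>, which is no more than its
  weight, and the weak version applies.\<close>

lemma feasible_potential_strict:
  fixes r :: "('n::finite \<times> 'n) set" and w :: "'n \<times> 'n \<Rightarrow> real"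
  assumes cycle: "\<And>us. \<lbrakk>us \<noteq> []; distinct us; \<forall>s\<in>set (zip us (rotate1 us)). s \<in> r\<rbrakk>
      \<Longrightarrow> 0 < sum_list (map w (zip us (rotate1 us)))"
  shows "\<exists>x. \<forall>(i, j)\<in>r. x i - x j < w (i, j)"
proof -
  define L where "L = {us. us \<noteq> [] \<and> distinct us \<and> (\<forall>s\<in>set (zip us (rotate1 us)). s \<in> r)}"
  \<comment> \<open>Inserting 1 keeps the minimum defined and positive when there are no
    cycles.\<close>
  define m where "m = Min (insert 1 ((\<lambda>us. sum_list (map w (zip us (rotate1 us)))) ` L))"
  define e where "e = m / real CARD('n)"
  have fin: "finite L"
    by (rule finite_subset[OF _ finite_subset_distinct[of "UNIV :: 'n set"]]) (auto simp: L_def)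
  have "m > 0"
    unfolding m_def using fin cycle by (subst Min_gr_iff) (auto simp: L_def)
  then have e: "e > 0" by (simp add: e_def)
  have "\<exists>x. \<forall>(i, j)\<in>r. x i - x j \<le> w (i, j) - e"
  proof -
    have "0 \<le> sum_list (map (\<lambda>s. w s - e) (zip us (rotate1 us)))" if us: "us \<in> L" for us
    proof -
      have "length us \<le> CARD('n)"
        using us by (auto simp: L_def distinct_card[symmetric] intro: card_mono)
      then have "e * real (length us) \<le> e * real CARD('n)"
        using e by (intro mult_left_mono) auto
      also have "\<dots> = m" by (simp add: e_def)
      also have "m \<le> sum_list (map w (zip us (rotate1 us)))"
        unfolding m_def using fin us by (intro Min_le) auto
      finally show ?thesis
        by (simp add: sum_list_subtractf sum_list_triv mult.commute)
    qed
    then show ?thesis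
      using feasible_potential_weak[of r "\<lambda>s. w s - e"] by (auto simp: L_def)
  qed
  then obtain x where "\<And>i j. (i, j) \<in> r \<Longrightarrow> x i - x j \<le> w (i, j) - e"
    by blast
  then have "x i - x j < w (i, j)" if "(i, j) \<in> r" for i j
    using e that by (meson diff_less_eq less_add_same_cancel1 order_le_less_trans)
  then show ?thesis by blast
qed

section \<open>Cells of the arrangement\<close>

text \<open>A blank edge contributes two constraints, confining the difference to the open strip
  between its two hyperplanes; an oriented edge contributes one, an open half-space.\<close>

definition cell :: "'n::finite set set \<Rightarrow> ('n \<Rightarrow> 'n \<Rightarrow> real) \<Rightarrow> ('n \<times> 'n) set \<Rightarrow> (real ^ 'n) set" where
  "cell E A \<O> = {x. \<forall>i j. compatible E \<O> (i, j) \<longrightarrow> x $ i - x $ j < step_score A \<O> (i, j)}"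

definition point_orientation ::
    "'n::finite set set \<Rightarrow> ('n \<Rightarrow> 'n \<Rightarrow> real) \<Rightarrow> real ^ 'n \<Rightarrow> ('n \<times> 'n) set" where
  "point_orientation E A x = {(i, j) \<in> steps E. x $ j > x $ i + A j i}"

lemma steps_sym: "(i, j) \<in> steps E \<longleftrightarrow> (j, i) \<in> steps E"
  by (simp add: steps_def insert_commute)

text \<open>Thus \<open>- A j i < A i j\<close>: the two parallel hyperplanes of an edge bound a
  nonempty strip, and no point lies beyond both.\<close>

lemma parameter_list_sum_pos:
  assumes "parameter_list E A" "(i, j) \<in> steps E"
  shows "A i j + A j i > 0"
  using assms by (fastforce simp: parameter_list_def steps_def)

lemma inner_axis_diff: "(axis i 1 - axis j 1) \<bullet> (x :: real ^ 'n::finite) = x $ i - x $ j"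
  by (simp add: inner_diff_left inner_axis')

lemma convex_cell: "convex (cell E A \<O>)"
proof -
  have "cell E A \<O> = (\<Inter>(i, j)\<in>{s. compatible E \<O> s}.
      {x. (axis i 1 - axis j 1) \<bullet> x < step_score A \<O> (i, j)})"
    unfolding inner_axis_diff by (auto simp: cell_def)
  then show ?thesis
    by (auto intro!: convex_INT convex_halfspace_lt)
qed

text \<open>The thresholds \<open>- A j i < A i j\<close> cut the line into three open intervals for
  \<open>x $ i - x $ j\<close>; the orientation records which one occurs, and the constraints of the
  cell describe exactly that interval.\<close>

lemma mem_cell_iff:
  assumes A: "parameter_list E A" and po: "partial_orientation E \<O>"
  shows "x \<in> cell E A \<O> \<longleftrightarrow> x \<notin> \<Union>(arrangement E A) \<and> point_orientation E A x = \<O>"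
proof -
  have ne: "x \<notin> \<Union>(arrangement E A) \<longleftrightarrow> (\<forall>(i, j)\<in>steps E. x $ i - x $ j \<noteq> A i j)"
    by (auto simp: arrangement_def hyperplane_def)
  have sub: "\<O> \<subseteq> steps E" and anti: "\<And>u v. (u, v) \<in> \<O> \<Longrightarrow> (v, u) \<notin> \<O>"
    using po by (auto simp: partial_orientation_def)
  show ?thesis
  proof
    assume x: "x \<in> cell E A \<O>"
    have inO: "x $ j > x $ i + A j i" if "(i, j) \<in> \<O>" for i j
    proof -
      have "compatible E \<O> (i, j)"
        using that sub anti[OF that] by (auto simp: compatible_def)
      then have "x $ i - x $ j < step_score A \<O> (i, j)"
        using x by (simp add: cell_def)
      then show ?thesis using that by (simp add: step_score_def)
    qed
    have notO: "x $ j < x $ i + A j i" if "(i, j) \<in> steps E" "(i, j) \<notin> \<O>" for i j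
    proof (cases "(j, i) \<in> \<O>")
      case True
      with inO[OF True] parameter_list_sum_pos[OF A that(1)] show ?thesis by simp
    next
      case False
      have "compatible E \<O> (j, i)"
        using that False steps_sym[of i j E] by (auto simp: compatible_def)
      then have "x $ j - x $ i < step_score A \<O> (j, i)"
        using x by (auto simp: cell_def)
      then show ?thesis using False by (simp add: step_score_def)
    qed
    \<comment> \<open>The hyperplane of \<open>(i, j)\<close> is the threshold for membership of the
      reversed step \<open>(j, i)\<close>.\<close>
    have "x $ i - x $ j \<noteq> A i j" if "(i, j) \<in> steps E" for i j
      using inO[of j i] notO[of j i] that steps_sym[of i j E] by fastforce
    moreover have "point_orientation E A x = \<O>"
      using inO notO sub by (fastforce simp: point_orientation_def)
    ultimately show "x \<notin> \<Union>(arrangement E A) \<and> point_orientation E A x = \<O>"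
      using ne by auto
  next
    assume "x \<notin> \<Union>(arrangement E A) \<and> point_orientation E A x = \<O>"
    then have nz: "\<And>i j. (i, j) \<in> steps E \<Longrightarrow> x $ i - x $ j \<noteq> A i j"
      and O: "\<O> = point_orientation E A x"
      using ne by auto
    have "x $ i - x $ j < step_score A \<O> (i, j)" if "compatible E \<O> (i, j)" for i j
    proof (cases "(i, j) \<in> \<O>")
      case True
      then show ?thesis unfolding O by (auto simp: step_score_def point_orientation_def)
    next
      case False
      from that have "(i, j) \<in> steps E" "(j, i) \<notin> \<O>"
        by (auto simp: compatible_def)
      then have "x $ i - x $ j < A i j"
        using nz[of i j] steps_sym[of i j E] unfolding O by (auto simp: point_orientation_def)
      then show ?thesis using False by (simp add: step_score_def)
    qed
    then show "x \<in> cell E A \<O>" by (simp add: cell_def)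
  qed
qed

lemma partial_orientation_point:
  assumes "parameter_list E A"
  shows "partial_orientation E (point_orientation E A x)"
  using parameter_list_sum_pos[OF assms]
  by (fastforce simp: partial_orientation_def point_orientation_def)

text \<open>By the intermediate value property, a connected set with points on both sides of a
  hyperplane meets it. Exchanging \<open>x\<close> and \<open>y\<close> gives equality.\<close>

lemma point_orientation_const:
  assumes T: "connected T" "T \<inter> \<Union>(arrangement E A) = {}" and xy: "x \<in> T" "y \<in> T"
  shows "point_orientation E A x \<subseteq> point_orientation E A y"
proof (clarify)
  fix i j
  assume "(i, j) \<in> point_orientation E A x"
  then have ij: "(j, i) \<in> steps E" and x: "A j i \<le> (axis j 1 - axis i 1) \<bullet> x"
    unfolding inner_axis_diff by (auto simp: point_orientation_def steps_sym[of i j])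
  show "(i, j) \<in> point_orientation E A y"
  proof (rule ccontr)
    assume "(i, j) \<notin> point_orientation E A y"
    then have "(axis j 1 - axis i 1) \<bullet> y \<le> A j i"
      unfolding inner_axis_diff using ij by (auto simp: point_orientation_def steps_sym[of i j])
    from connected_ivt_hyperplane[OF T(1) xy(2,1) this x]
    obtain z where "z \<in> T" "z $ j - z $ i = A j i"
      unfolding inner_axis_diff by blast
    then show False
      using T(2) ij by (auto simp: arrangement_def hyperplane_def)
  qed
qed

text \<open>The cell is convex, hence connected, so it lies in the component; the orientation is
  constant on the component, so the component lies in the cell.\<close>

lemma component_eq_cell:
  assumes A: "parameter_list E A" and x: "x \<notin> \<Union>(arrangement E A)"
  shows "connected_component_set (- \<Union>(arrangement E A)) x = cell E A (point_orientation E A x)"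
    (is "connected_component_set ?U x = ?c")
proof
  have mem: "y \<in> ?c \<longleftrightarrow> y \<in> ?U \<and> point_orientation E A y = point_orientation E A x" for y
    using mem_cell_iff[OF A partial_orientation_point[OF A]] by auto
  show "?c \<subseteq> connected_component_set ?U x"
    using mem x by (intro connected_component_maximal convex_connected convex_cell) auto
  let ?T = "connected_component_set ?U x"
  have T: "connected ?T" "?T \<inter> \<Union>(arrangement E A) = {}" "x \<in> ?T"
    using connected_component_subset[of ?U x] x by auto
  show "?T \<subseteq> ?c"
  proof
    fix y assume y: "y \<in> ?T"
    then have "point_orientation E A y = point_orientation E A x"
      using point_orientation_const[OF T(1,2)] T(3) by blast
    then show "y \<in> ?c" using mem T(2) y by blast
  qed
qed

lemma region_orientation_cell:
  assumes A: "parameter_list E A" and po: "partial_orientation E \<O>" and ne: "cell E A \<O> \<noteq> {}"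
  shows "region_orientation E A (cell E A \<O>) = \<O>"
proof -
  have "point_orientation E A x = \<O>" if "x \<in> cell E A \<O>" for x
    using that mem_cell_iff[OF A po] by blast
  \<comment> \<open>Nonemptiness matters: for empty \<open>R\<close> the left side is
    \<open>steps E\<close>, the right side everything.\<close>
  moreover have "region_orientation E A R = (\<Inter>x\<in>R. point_orientation E A x)" if "R \<noteq> {}" for R
    using that by (auto simp: region_orientation_def point_orientation_def)
  ultimately show ?thesis using ne by simp
qed

lemma cell_in_regions:
  assumes A: "parameter_list E A" and po: "partial_orientation E \<O>" and ne: "cell E A \<O> \<noteq> {}"
  shows "cell E A \<O> \<in> regions E A"
proof -
  from ne obtain x where "x \<in> cell E A \<O>" by blast
  then have "x \<notin> \<Union>(arrangement E A)" "point_orientation E A x = \<O>"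
    using mem_cell_iff[OF A po] by auto
  then show ?thesis
    using component_eq_cell[OF A, of x] unfolding regions_def components_def by auto
qed

lemma region_is_cell:
  assumes A: "parameter_list E A" and R: "R \<in> regions E A"
  shows "\<exists>\<O>. partial_orientation E \<O> \<and> cell E A \<O> \<noteq> {} \<and> R = cell E A \<O>"
proof -
  from R obtain x where x: "x \<notin> \<Union>(arrangement E A)"
    and "R = connected_component_set (- \<Union>(arrangement E A)) x"
    by (auto simp: regions_def components_def)
  then have "R = cell E A (point_orientation E A x)"
    using component_eq_cell[OF A x] by simp
  moreover have "R \<noteq> {}"
    using in_components_nonempty R unfolding regions_def by blast
  ultimately show ?thesis
    using partial_orientation_point[OF A] by blast
qed

section \<open>Nonempty cells and admissible orientations\<close>

lemma cycle_score_conv: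
  assumes "distinct us"
  shows "cycle_score A \<O> (set (zip us (rotate1 us)))
    = sum_list (map (step_score A \<O>) (zip us (rotate1 us)))"
  unfolding cycle_score_def by (intro sum.distinct_set_conv_list distinct_zipI1 assms)

text \<open>Each vertex of the cycle is the tail of one step and the head of one, so the coordinate
  differences cancel.\<close>

lemma cycle_slack_sum:
  fixes x :: "real ^ 'n::finite"
  assumes "potential_cycle E \<O> C"
  shows "(\<Sum>(i, j)\<in>C. step_score A \<O> (i, j) - (x $ i - x $ j)) = cycle_score A \<O> C"
proof -
  from assms obtain us where us: "us \<noteq> []" "distinct us" "C = set (zip us (rotate1 us))"
    by (auto simp: potential_cycle_def)
  have "(\<Sum>(i, j)\<in>C. x $ i - x $ j) = (\<Sum>s\<leftarrow>zip us (rotate1 us). x $ fst s - x $ snd s)"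
    unfolding us(3) case_prod_unfold by (intro sum.distinct_set_conv_list distinct_zipI1 us(2))
  also have "\<dots> = (\<Sum>i\<leftarrow>map fst (zip us (rotate1 us)). x $ i)
      - (\<Sum>i\<leftarrow>map snd (zip us (rotate1 us)). x $ i)"
    unfolding sum_list_subtractf map_map o_def ..
  also have "\<dots> = (\<Sum>i\<leftarrow>us. x $ i) - (\<Sum>i\<leftarrow>rotate1 us. x $ i)"
    by (simp add: map_fst_zip map_snd_zip)
  also have "\<dots> = 0"
    by (cases us) auto
  finally show ?thesis
    by (simp add: cycle_score_def sum_subtractf case_prod_unfold)
qed

lemma cell_slack_less:
  assumes "x \<in> cell E A \<O>" "potential_cycle E \<O> C" "s \<in> C"
  shows "case s of (i, j) \<Rightarrow> 0 < step_score A \<O> (i, j) - (x $ i - x $ j)"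
  using assms by (auto simp: cell_def potential_cycle_def)

lemma potential_cycle_finite_nonempty:
  assumes "potential_cycle E \<O> C"
  shows "finite C" "C \<noteq> {}"
proof -
  from assms obtain us where us: "us \<noteq> []" "C = set (zip us (rotate1 us))"
    by (auto simp: potential_cycle_def)
  then show "finite C" "C \<noteq> {}"
    by (auto simp: zip_eq_Nil_iff)
qed

lemma cell_nonempty_iff_admissible:
  "cell E A \<O> \<noteq> {} \<longleftrightarrow> admissible E A \<O>"
proof
  assume "cell E A \<O> \<noteq> {}"
  then obtain x where x: "x \<in> cell E A \<O>" by blast
  show "admissible E A \<O>"
    unfolding admissible_def
  proof (intro allI impI)
    fix C assume C: "potential_cycle E \<O> C"
    have "0 < (\<Sum>(i, j)\<in>C. step_score A \<O> (i, j) - (x $ i - x $ j))"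
      using cell_slack_less[OF x C]
      by (intro sum_pos potential_cycle_finite_nonempty[OF C]) fastforce
    then show "0 < cycle_score A \<O> C"
      by (simp only: cycle_slack_sum[OF C])
  qed
next
  assume adm: "admissible E A \<O>"
  have "0 < sum_list (map (step_score A \<O>) (zip us (rotate1 us)))"
    if "us \<noteq> []" "distinct us" "\<forall>s\<in>set (zip us (rotate1 us)). s \<in> {s. compatible E \<O> s}" for us
  proof -
    have "potential_cycle E \<O> (set (zip us (rotate1 us)))"
      unfolding potential_cycle_def using that by auto
    then show ?thesis
      using adm cycle_score_conv[OF that(2), of A \<O>] by (auto simp: admissible_def)
  qed
  then have "\<exists>x. \<forall>(i, j)\<in>{s. compatible E \<O> s}. x i - x j < step_score A \<O> (i, j)"
    by (rule feasible_potential_strict)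
  then obtain x where "\<And>i j. compatible E \<O> (i, j) \<Longrightarrow> x i - x j < step_score A \<O> (i, j)"
    by auto
  then have "(\<chi> i. x i) \<in> cell E A \<O>"
    by (simp add: cell_def)
  then show "cell E A \<O> \<noteq> {}" by blast
qed

section \<open>Relative boundedness\<close>

text \<open>Pairing \<open>f x\<close> with \<open>x\<close> gives the sum of the squares of
  \<open>n \<bullet> x\<close>, so the linear map \<open>f\<close> is injective on the span. In
  finite dimension it is then bounded below there, and bounds on the inner products bound the
  norm.\<close>

lemma bounded_span_if_bounded_inner:
  fixes N :: "'a::euclidean_space set"
  assumes N: "finite N" and B: "\<And>x n. x \<in> S \<Longrightarrow> n \<in> N \<Longrightarrow> \<bar>n \<bullet> x\<bar> \<le> B n"
  shows "bounded (S \<inter> span N)"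
proof -
  define f where "f x = (\<Sum>n\<in>N. (n \<bullet> x) *\<^sub>R n)" for x
  have lin: "bounded_linear f"
    unfolding f_def
    by (intro bounded_linear_sum bounded_linear_scaleR_const bounded_linear_inner_right)
  have inj: "x = 0" if x: "x \<in> span N" "f x = 0" for x
  proof -
    have "(\<Sum>n\<in>N. (n \<bullet> x)\<^sup>2) = f x \<bullet> x"
      by (simp add: f_def inner_sum_left power2_eq_square)
    then have "n \<bullet> x = 0" if "n \<in> N" for n
      using x(2) N that by (simp add: sum_nonneg_eq_0_iff)
    \<comment> \<open>A vector in the span of \<open>N\<close> that is orthogonal to
      \<open>N\<close> is orthogonal to itself.\<close>
    then have "orthogonal x x"
      by (intro orthogonal_to_span[OF x(1)]) (simp add: orthogonal_def inner_commute)
    then show ?thesis by (simp add: orthogonal_def)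
  qed
  obtain e where e: "e > 0" "\<And>x. x \<in> span N \<Longrightarrow> e * norm x \<le> norm (f x)"
    using injective_imp_isometric[of "span N" f] lin inj closed_span by fastforce
  have "norm x \<le> (\<Sum>n\<in>N. B n * norm n) / e" if x: "x \<in> S \<inter> span N" for x
  proof -
    have "e * norm x \<le> norm (f x)" using e x by simp
    also have "\<dots> \<le> (\<Sum>n\<in>N. B n * norm n)"
      unfolding f_def using x B by (intro sum_norm_le) (auto intro!: mult_right_mono)
    finally show ?thesis using e(1) by (simp add: field_simps)
  qed
  then show ?thesis by (rule boundedI)
qed

text \<open>A compatible step outside the orientation lies on a blank edge, and going back and forth
  along that edge is a potential cycle.\<close>

lemma compatible_step_in_cycle:
  assumes G: "simple_graph E" and cyc: "\<forall>s\<in>\<O>. \<exists>C. potential_cycle E \<O> C \<and> s \<in> C"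
    and c: "compatible E \<O> (i, j)"
  shows "\<exists>C. potential_cycle E \<O> C \<and> (i, j) \<in> C"
proof (cases "(i, j) \<in> \<O>")
  case False
  have ij: "(i, j) \<in> steps E" using c by (simp add: compatible_def)
  then have "i \<noteq> j" using G by (auto simp: simple_graph_def steps_def)
  then have "potential_cycle E \<O> (set (zip [i, j] (rotate1 [i, j])))"
    unfolding potential_cycle_def using c False ij steps_sym[of i j E]
    by (intro exI[of _ "[i, j]"]) (auto simp: compatible_def)
  then show ?thesis by fastforce
qed (use cyc in blast)

lemma relatively_bounded_cell:
  fixes E :: "'n::finite set set"
  assumes G: "simple_graph E" and po: "partial_orientation E \<O>"
    and cyc: "\<forall>s\<in>\<O>. \<exists>C. potential_cycle E \<O> C \<and> s \<in> C"
  shows "relatively_bounded E (cell E A \<O>)"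
proof -
  have comp: "\<exists>B. \<forall>x\<in>cell E A \<O>. \<bar>x $ i - x $ j\<bar> \<le> B" if c: "compatible E \<O> (i, j)" for i j
  proof -
    obtain C where C: "potential_cycle E \<O> C" "(i, j) \<in> C"
      using compatible_step_in_cycle[OF G cyc c] by blast
    \<comment> \<open>The slack of \<open>(i, j)\<close> lies between 0 and the score of the cycle,
      so the difference is the score of the step up to that amount.\<close>
    define B where "B = \<bar>step_score A \<O> (i, j)\<bar> + \<bar>cycle_score A \<O> C\<bar>"
    have "\<bar>x $ i - x $ j\<bar> \<le> B" if x: "x \<in> cell E A \<O>" for x
    proof -
      let ?g = "\<lambda>(i, j). step_score A \<O> (i, j) - (x $ i - x $ j)"
      have "?g (i, j) \<le> sum ?g C"
        using C(2) potential_cycle_finite_nonempty(1)[OF C(1)] cell_slack_less[OF x C(1)]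
        by (intro member_le_sum) (auto intro: less_imp_le)
      moreover have "0 < ?g (i, j)"
        using cell_slack_less[OF x C] by simp
      ultimately show ?thesis
        using cycle_slack_sum[OF C(1), of A x] by (simp add: B_def)
    qed
    then show ?thesis by blast
  qed
  have "\<exists>B. \<forall>x\<in>cell E A \<O>. \<bar>n \<bullet> x\<bar> \<le> B" if n: "n \<in> normals E" for n
  proof -
    from n obtain i j where ij: "(i, j) \<in> steps E" and n: "n = axis i 1 - axis j 1"
      by (auto simp: normals_def)
    \<comment> \<open>At most one direction of an edge is oriented, so at least one is compatible;
      reversing a step only changes the sign of its normal.\<close>
    consider "compatible E \<O> (i, j)" | "compatible E \<O> (j, i)"
      using ij po steps_sym[of i j E] by (auto simp: compatible_def partial_orientation_def)
    then show ?thesis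
    proof cases
      case 1
      from comp[OF this] show ?thesis by (simp add: n inner_axis_diff)
    next
      case 2
      from comp[OF this] show ?thesis
        by (simp add: n inner_axis_diff abs_minus_commute)
    qed
  qed
  then obtain B where "\<And>x n. x \<in> cell E A \<O> \<Longrightarrow> n \<in> normals E \<Longrightarrow> \<bar>n \<bullet> x\<bar> \<le> B n"
    by metis
  moreover have "finite (normals E)" by (simp add: normals_def)
  ultimately show ?thesis
    unfolding relatively_bounded_def by (intro bounded_span_if_bounded_inner)
qed

lemma step_in_cycle_if_relatively_bounded:
  fixes E :: "'n::finite set set"
  assumes po: "partial_orientation E \<O>"
    and ne: "cell E A \<O> \<noteq> {}" and bd: "relatively_bounded E (cell E A \<O>)"
    and uv: "(u, v) \<in> \<O>"
  shows "\<exists>C. potential_cycle E \<O> C \<and> (u, v) \<in> C"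
proof -
  define r where "r = {s. compatible E \<O> s}"
  have uvr: "(u, v) \<in> r" and uvs: "(u, v) \<in> steps E"
    using uv po by (auto simp: r_def compatible_def partial_orientation_def)
  have "(v, u) \<in> r\<^sup>*"
  proof (rule ccontr)
    assume nr: "(v, u) \<notin> r\<^sup>*"
    \<comment> \<open>The indicator of the set reachable from \<open>v\<close> is a direction of recession of the cell.
      Its projection to the span of the normals has the same coordinate differences along edges.\<close>
    define y :: "real ^ 'n" where "y = (\<chi> i. if (v, i) \<in> r\<^sup>* then 1 else 0)"
    \<comment> \<open>Reachability from \<open>v\<close> passes along compatible steps, so adding a
      nonnegative multiple of \<open>y\<close> cannot violate a constraint.\<close>
    have mono: "y $ i \<le> y $ j" if "compatible E \<O> (i, j)" for i j
      using that by (auto simp: y_def r_def intro: rtrancl_into_rtrancl)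
    have proj: "\<exists>z'\<in>span (normals E). \<forall>(i, j)\<in>steps E. z' $ i - z' $ j = z $ i - z $ j" for z
    proof -
      obtain z' d where z': "z' \<in> span (normals E)"
        and d: "\<And>w. w \<in> span (normals E) \<Longrightarrow> orthogonal d w" and z: "z = z' + d"
        using orthogonal_subspace_decomp_exists[of "normals E" z] by blast
      have "d $ i - d $ j = 0" if "(i, j) \<in> steps E" for i j
      proof -
        have "axis i 1 - axis j 1 \<in> span (normals E)"
          using that by (intro span_base) (auto simp: normals_def)
        from d[OF this] show ?thesis
          by (simp add: orthogonal_def inner_commute[of d] inner_axis_diff)
      qed
      then show ?thesis using z' z by (intro bexI[of _ z']) auto
    qed
    obtain x where x: "x \<in> cell E A \<O>" using ne by blast
    obtain x' y' where x': "x' \<in> span (normals E)" "\<And>i j. (i, j) \<in> steps E \<Longrightarrow> x' $ i - x' $ j = x $ i - x $ j"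
      and y': "y' \<in> span (normals E)" "\<And>i j. (i, j) \<in> steps E \<Longrightarrow> y' $ i - y' $ j = y $ i - y $ j"
      using proj[of x] proj[of y] by blast
    have ray: "x' + t *\<^sub>R y' \<in> cell E A \<O> \<inter> span (normals E)" if "t \<ge> 0" for t
    proof
      show "x' + t *\<^sub>R y' \<in> span (normals E)"
        using x' y' by (intro span_add span_scale)
      have "(x' + t *\<^sub>R y') $ i - (x' + t *\<^sub>R y') $ j < step_score A \<O> (i, j)"
        if c: "compatible E \<O> (i, j)" for i j
      proof -
        have ij: "(i, j) \<in> steps E" using c by (simp add: compatible_def)
        have "(x' + t *\<^sub>R y') $ i - (x' + t *\<^sub>R y') $ j
            = (x' $ i - x' $ j) + t * (y' $ i - y' $ j)"
          by (simp add: algebra_simps)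
        also have "\<dots> = (x $ i - x $ j) + t * (y $ i - y $ j)"
          using x'(2) y'(2) ij by simp
        also have "\<dots> \<le> x $ i - x $ j"
          using mono[OF c] \<open>t \<ge> 0\<close> by (simp add: mult_nonneg_nonpos)
        also have "\<dots> < step_score A \<O> (i, j)"
          using x c by (simp add: cell_def)
        finally show ?thesis .
      qed
      then show "x' + t *\<^sub>R y' \<in> cell E A \<O>" by (simp add: cell_def)
    qed
    \<comment> \<open>Here \<open>v\<close> is reachable from itself and \<open>u\<close> is not, so
      the direction survives the projection.\<close>
    have "y' $ u - y' $ v = - 1"
      using y'(2)[OF uvs] nr by (simp add: y_def)
    then have y'0: "norm y' > 0" by auto
    obtain b where b: "\<And>z. z \<in> cell E A \<O> \<inter> span (normals E) \<Longrightarrow> norm z \<le> b"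
      using bd unfolding relatively_bounded_def bounded_iff by blast
    \<comment> \<open>Chosen so that the point at parameter \<open>t\<close> has norm at least
      \<open>t * norm y' - norm x' = \<bar>b\<bar> + 1\<close>, exceeding the bound
      \<open>b\<close>.\<close>
    define t where "t = (\<bar>b\<bar> + norm x' + 1) / norm y'"
    have t: "t \<ge> 0" "t * norm y' = \<bar>b\<bar> + norm x' + 1"
      using y'0 by (auto simp: t_def)
    have "t * norm y' \<le> norm (x' + t *\<^sub>R y') + norm x'"
      using norm_triangle_ineq4[of "x' + t *\<^sub>R y'" x'] t(1) by simp
    with b[OF ray[OF t(1)]] t(2) show False by linarith
  qed
  then obtain p where p: "distinct (v # p)" "last (v # p) = u"
      "successively (\<lambda>u v. (u, v) \<in> r) (v # p)"
    using rtrancl_imp_simple_path by metis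
  let ?C = "set (zip (v # p) (rotate1 (v # p)))"
  \<comment> \<open>The step \<open>(u, v)\<close> closes the simple path from \<open>v\<close> to
    \<open>u\<close> into a cycle.\<close>
  have "successively (\<lambda>u v. (u, v) \<in> r) ((v # p) @ [v])"
    using p uvr by (subst successively_append_iff) auto
  then have "\<forall>s\<in>?C. s \<in> r"
    using ball_zip_shift[of v p v r] by simp
  then have "potential_cycle E \<O> ?C"
    unfolding potential_cycle_def r_def using p(1) by blast
  moreover have "(u, v) \<in> ?C"
  proof -
    have "v # p = butlast (v # p) @ [u]" using p(2) by (metis append_butlast_last_id list.distinct(1))
    then have "zip (v # p) (p @ [v]) = zip (butlast (v # p) @ [u]) (p @ [v])" by simp
    also have "\<dots> = zip (butlast (v # p)) p @ [(u, v)]"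
      by (subst zip_append) auto
    finally show ?thesis by simp
  qed
  ultimately show ?thesis by blast
qed

theorem mainTheorem2:
  fixes E :: "'n::finite set set" and A :: "'n \<Rightarrow> 'n \<Rightarrow> real"
  assumes "simple_graph E" and "parameter_list E A"
  shows "bij_betw (region_orientation E A)
           {R \<in> regions E A. relatively_bounded E R}
           {\<O>. partial_orientation E \<O> \<and> admissible E A \<O> \<and>
                (\<forall>s\<in>\<O>. \<exists>C. potential_cycle E \<O> C \<and> s \<in> C)}"
    (is "bij_betw _ ?R ?O")
proof -
  have R: "region_orientation E A R \<in> ?O \<and> cell E A (region_orientation E A R) = R"
    if R: "R \<in> ?R" for R
  proof -
    obtain \<O> where \<O>: "partial_orientation E \<O>" "cell E A \<O> \<noteq> {}" "R = cell E A \<O>"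
      using region_is_cell[OF assms(2)] R by blast
    then have "\<exists>C. potential_cycle E \<O> C \<and> s \<in> C" if "s \<in> \<O>" for s
      using step_in_cycle_if_relatively_bounded[OF \<O>(1,2), of "fst s" "snd s"] R that by auto
    then show ?thesis
      using \<O> region_orientation_cell[OF assms(2) \<O>(1,2)] cell_nonempty_iff_admissible[of E A \<O>]
      by auto
  qed
  have O: "cell E A \<O> \<in> ?R \<and> region_orientation E A (cell E A \<O>) = \<O>" if "\<O> \<in> ?O" for \<O>
  proof -
    from that have \<O>: "partial_orientation E \<O>" "cell E A \<O> \<noteq> {}"
        "\<forall>s\<in>\<O>. \<exists>C. potential_cycle E \<O> C \<and> s \<in> C"
      using cell_nonempty_iff_admissible[of E A \<O>] by auto
    then show ?thesis
      using cell_in_regions[OF assms(2) \<O>(1,2)] region_orientation_cell[OF assms(2) \<O>(1,2)]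
        relatively_bounded_cell[OF assms(1) \<O>(1,3)] by auto
  qed
  show ?thesis
    \<comment> \<open>The inverse map sends an orientation to its cell.\<close>
    using R O by (intro bij_betw_byWitness[where f' = "cell E A"]) auto
qed

end
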